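(* Let $A\in\mathbb{R}^{d\times n}$ satisfy $rk_t(A)=r$ and $rk_K(A)>r$. Then there exists $B\in\mathbb{R}^{(d+1)\times(n+1)}$ with $rk_t(B)=r+1$ and $rk_K(B)>r+1$.
   Context: Tropical rank $rk_t$: largest $r$ such that the matrix has an $r\times r$ submatrix $S$ for which $\min_{\sigma}\sum_i s_{i\sigma(i)}$ is attained by exactly one permutation. Kapranov rank $rk_K(B)$: minimal rank over $\mathbf K$ of a matrix $A\in\mathbf K^{m\times n}$ with $\deg a_{ij}=b_{ij}$, where $\mathbf K$ is the field of formal sums $\sum_{e\in\mathbb{R}}a_et^e$ ($a_e\in\mathbb{C}$) with well-ordered support and $\deg$ is the minimal exponent ($\deg 0=\infty$). *)

theory Defs
  imports
    "HOL-Library.Extended_Real"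
    "HOL-Combinatorics.Permutations"
    "Jordan_Normal_Form.DL_Rank_Submatrix"
begin

section \<open>Well-ordered sets of reals\<close>

text \<open>Since the order on the reals is total, \<open>wfp_on S (<)\<close> says precisely that
  \<open>S\<close> is well-ordered.\<close>

lemma wo_real_iff:
  fixes S :: "real set"
  shows "wfp_on S (<) \<longleftrightarrow> (\<forall>T\<subseteq>S. T \<noteq> {} \<longrightarrow> (\<exists>m\<in>T. \<forall>x\<in>T. m \<le> x))"
  unfolding wfp_on_iff_ex_minimal by (meson not_less)

lemma wo_real_min:
  fixes S :: "real set"
  assumes "wfp_on S (<)" "T \<subseteq> S" "T \<noteq> {}"
  obtains m where "m \<in> T" "\<And>x. x \<in> T \<Longrightarrow> m \<le> x"
  using assms wo_real_iff by meson

lemma wo_real_no_descent: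
  fixes s :: "nat \<Rightarrow> real"
  assumes "wfp_on S (<)" "\<And>n. s n \<in> S" "\<And>n. s (Suc n) < s n"
  shows False
proof -
  obtain m where m: "m \<in> range s" "\<And>x. x \<in> range s \<Longrightarrow> m \<le> x"
    using wo_real_min[OF assms(1), of "range s"] assms(2) by auto
  then obtain n where "m = s n" by auto
  then show False using m(2)[of "s (Suc n)"] assms(3)[of n] by auto
qed

lemma wo_real_descent:
  fixes S :: "real set"
  assumes "\<not> wfp_on S (<)"
  obtains s where "\<And>n::nat. s n \<in> S" "\<And>n. s (Suc n) < s n"
proof -
  obtain T where T: "T \<subseteq> S" "T \<noteq> {}" "\<forall>m\<in>T. \<exists>x\<in>T. x < m"
    using assms unfolding wo_real_iff by (meson not_le)
  have "\<exists>f. \<forall>n::nat. f n \<in> T \<and> f (Suc n) < f n"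
    by (rule dependent_nat_choice) (use T in blast)+
  then show ?thesis using T(1) that by blast
qed

lemma wo_real_Un:
  fixes A B :: "real set"
  assumes A: "wfp_on A (<)" and B: "wfp_on B (<)"
  shows "wfp_on (A \<union> B) (<)"
  unfolding wo_real_iff
proof (intro allI impI)
  fix T assume T: "T \<subseteq> A \<union> B" "T \<noteq> {}"
  consider "T \<inter> A = {}" | "T \<inter> B = {}" | "T \<inter> A \<noteq> {}" "T \<inter> B \<noteq> {}" by blast
  then show "\<exists>m\<in>T. \<forall>x\<in>T. m \<le> x"
  proof cases
    case 1 then have "T \<subseteq> B" using T by blast
    then show ?thesis using B T(2) wo_real_iff by blast
  next
    case 2 then have "T \<subseteq> A" using T by blast
    then show ?thesis using A T(2) wo_real_iff by blast
  next
    case 3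
    obtain a where a: "a \<in> T \<inter> A" "\<And>x. x \<in> T \<inter> A \<Longrightarrow> a \<le> x"
      using wo_real_min[OF A _ 3(1)] by blast
    obtain b where b: "b \<in> T \<inter> B" "\<And>x. x \<in> T \<inter> B \<Longrightarrow> b \<le> x"
      using wo_real_min[OF B _ 3(2)] by blast
    have "min a b \<in> T" using a(1) b(1) by (simp add: min_def)
    moreover have "\<forall>x\<in>T. min a b \<le> x" using a(2) b(2) T(1) by (fastforce simp: min_le_iff_disj)
    ultimately show ?thesis by blast
  qed
qed

lemma wo_real_singleton: "wfp_on {a::real} (<)"
  unfolding wo_real_iff by blast

lemma wo_real_insert: "wfp_on A (<) \<Longrightarrow> wfp_on (insert (a::real) A) (<)"
  using wo_real_Un[OF wo_real_singleton] by simp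

lemma wo_real_incseq_subseq:
  fixes s :: "nat \<Rightarrow> real"
  assumes A: "wfp_on A (<)" and s: "\<And>n. s n \<in> A"
  obtains f :: "nat \<Rightarrow> nat" where "strict_mono f" "incseq (\<lambda>n. s (f n))"
proof -
  obtain f :: "nat \<Rightarrow> nat" where f: "strict_mono f" "monoseq (\<lambda>n. s (f n))"
    using seq_monosub[of s] by auto
  show ?thesis
  proof (cases "incseq (\<lambda>n. s (f n))")
    case True then show ?thesis using f that by blast
  next
    case False
    then have dec: "decseq (\<lambda>n. s (f n))" using f(2) by (simp add: monoseq_iff)
    obtain m where m: "m \<in> range (\<lambda>n. s (f n))" "\<And>x. x \<in> range (\<lambda>n. s (f n)) \<Longrightarrow> m \<le> x"
      using wo_real_min[OF A, of "range (\<lambda>n. s (f n))"] s by auto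
    then obtain N where N: "m = s (f N)" by auto
    have "s (f (N + n)) = m" for n
      using m(2)[of "s (f (N + n))"] decseqD[OF dec, of N "N + n"] N by auto
    then have "incseq (\<lambda>n. s (f (N + n)))" by (simp add: incseq_def)
    moreover have "strict_mono (\<lambda>n. f (N + n))"
      using f(1) by (simp add: strict_mono_def)
    ultimately show ?thesis using that[of "\<lambda>n. f (N + n)"] by blast
  qed
qed

definition set_plus_real :: "real set \<Rightarrow> real set \<Rightarrow> real set" where
  "set_plus_real A B = {a + b |a b. a \<in> A \<and> b \<in> B}"

lemma set_plus_realI: "a \<in> A \<Longrightarrow> b \<in> B \<Longrightarrow> a + b \<in> set_plus_real A B"
  unfolding set_plus_real_def by blast

lemma wo_real_plus:
  assumes A: "wfp_on A (<)" and B: "wfp_on B (<)"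
  shows "wfp_on (set_plus_real A B) (<)"
proof (rule ccontr)
  assume "\<not> ?thesis"
  then obtain s where s: "\<And>n::nat. s n \<in> set_plus_real A B" "\<And>n. s (Suc n) < s n"
    by (rule wo_real_descent) blast
  from s(1) have "\<forall>n. \<exists>a b. a \<in> A \<and> b \<in> B \<and> s n = a + b"
    unfolding set_plus_real_def by blast
  then obtain a b where ab: "\<And>n. a n \<in> A" "\<And>n. b n \<in> B" "\<And>n. s n = a n + b n"
    by metis
  obtain f :: "nat \<Rightarrow> nat" where f: "strict_mono f" "incseq (\<lambda>n. a (f n))"
    using wo_real_incseq_subseq[OF A, of a] ab(1) by blast
  have "b (f (Suc n)) < b (f n)" for n
  proof -
    have "f n < f (Suc n)" using f(1) by (simp add: strict_mono_def)
    then have "s (f (Suc n)) < s (f n)" using lift_Suc_mono_less[of "\<lambda>n. - s n"] s(2) by simp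
    moreover have "a (f n) \<le> a (f (Suc n))" using f(2) by (simp add: incseq_def)
    ultimately show ?thesis using ab(3) by (smt (verit))
  qed
  then show False using wo_real_no_descent[OF B, of "\<lambda>n. b (f n)"] ab(2) by blast
qed

definition sum_pairs :: "real set \<Rightarrow> real set \<Rightarrow> real \<Rightarrow> (real \<times> real) set" where
  "sum_pairs A B e = {(a, b). a \<in> A \<and> b \<in> B \<and> a + b = e}"

lemma finite_sum_pairs:
  assumes A: "wfp_on A (<)" and B: "wfp_on B (<)"
  shows "finite (sum_pairs A B e)"
proof (rule ccontr)
  assume inf: "infinite (sum_pairs A B e)"
  have "inj_on fst (sum_pairs A B e)"
    by (auto simp: inj_on_def sum_pairs_def)
  then have "infinite (fst ` sum_pairs A B e)" using inf finite_imageD by blast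
  then obtain s :: "nat \<Rightarrow> real" where s: "inj s" "range s \<subseteq> fst ` sum_pairs A B e"
    using infinite_countable_subset by blast
  have s_mem: "s n \<in> A \<and> e - s n \<in> B" for n
  proof -
    have "s n \<in> fst ` sum_pairs A B e" using s(2) by blast
    then show ?thesis by (auto simp: sum_pairs_def)
  qed
  then have sA: "s n \<in> A" and sB: "e - s n \<in> B" for n by blast+
  obtain f :: "nat \<Rightarrow> nat" where f: "strict_mono f" "incseq (\<lambda>n. s (f n))"
    using wo_real_incseq_subseq[OF A, of s] sA by blast
  have "e - s (f (Suc n)) < e - s (f n)" for n
  proof -
    have "f n \<noteq> f (Suc n)" using f(1) by (simp add: strict_mono_eq)
    then have "s (f n) \<noteq> s (f (Suc n))" using s(1) by (simp add: inj_eq)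
    moreover have "s (f n) \<le> s (f (Suc n))" using f(2) by (simp add: incseq_def)
    ultimately show ?thesis by simp
  qed
  then show False using wo_real_no_descent[OF B, of "\<lambda>n. e - s (f n)"] sB by blast
qed


section \<open>The field of formal sums with well-ordered real exponents\<close>

text \<open>An element is represented by its coefficient function.\<close>

typedef hahn = "{f :: real \<Rightarrow> complex. wfp_on {e. f e \<noteq> 0} (<)}"
  morphisms hcoeff Abs_hahn
  by (rule exI[of _ "\<lambda>_. 0"]) (simp add: wo_real_iff)

definition hsupp :: "hahn \<Rightarrow> real set" where
  "hsupp f = {e. hcoeff f e \<noteq> 0}"

lemma wo_hsupp: "wfp_on (hsupp f) (<)"
  using hcoeff[of f] by (simp add: hsupp_def)

lemma hcoeff_Abs:
  assumes "wfp_on S (<)" "\<And>e. e \<notin> S \<Longrightarrow> g e = 0"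
  shows "hcoeff (Abs_hahn g) = g"
proof -
  have "{e. g e \<noteq> 0} \<subseteq> S" using assms(2) by blast
  then have "wfp_on {e. g e \<noteq> 0} (<)" using assms(1) wfp_on_subset by blast
  then show ?thesis by (simp add: Abs_hahn_inverse)
qed

lemma hahn_eqI: "(\<And>e. hcoeff f e = hcoeff g e) \<Longrightarrow> f = g"
  by (simp add: hcoeff_inject[symmetric] ext)

lemma hcoeff_notin: "e \<notin> hsupp f \<Longrightarrow> hcoeff f e = 0"
  by (simp add: hsupp_def)

definition hmonom :: "complex \<Rightarrow> real \<Rightarrow> hahn" where
  "hmonom c v = Abs_hahn (\<lambda>e. if e = v then c else 0)"

lemma hcoeff_monom: "hcoeff (hmonom c v) e = (if e = v then c else 0)"
  unfolding hmonom_def by (subst hcoeff_Abs[OF wo_real_singleton[of v]]) auto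

instantiation hahn :: "{zero, one, plus, minus, uminus, times, inverse}"
begin

definition "0 = Abs_hahn (\<lambda>_. 0)"
definition "1 = hmonom 1 0"
definition "f + g = Abs_hahn (\<lambda>e. hcoeff f e + hcoeff g e)"
definition "f - g = Abs_hahn (\<lambda>e. hcoeff f e - hcoeff g e)"
definition "- f = Abs_hahn (\<lambda>e. - hcoeff f e)"
definition "f * g = Abs_hahn (\<lambda>e. \<Sum>(a, b)\<in>sum_pairs (hsupp f) (hsupp g) e. hcoeff f a * hcoeff g b)"
definition "inverse f = (if f = 0 then 0 else THE g. f * g = (1::hahn))"
definition "(f::hahn) div g = f * inverse g"

instance ..
end

lemma hcoeff_0 [simp]: "hcoeff 0 e = 0"
  unfolding zero_hahn_def by (subst hcoeff_Abs[OF wo_real_singleton]) auto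

lemma hcoeff_1: "hcoeff 1 e = (if e = 0 then 1 else 0)"
  by (simp add: one_hahn_def hcoeff_monom)

lemma hcoeff_add [simp]: "hcoeff (f + g) e = hcoeff f e + hcoeff g e"
  unfolding plus_hahn_def
  by (subst hcoeff_Abs[OF wo_real_Un[OF wo_hsupp[of f] wo_hsupp[of g]]]) (auto simp: hsupp_def)

lemma hcoeff_diff [simp]: "hcoeff (f - g) e = hcoeff f e - hcoeff g e"
  unfolding minus_hahn_def
  by (subst hcoeff_Abs[OF wo_real_Un[OF wo_hsupp[of f] wo_hsupp[of g]]]) (auto simp: hsupp_def)

lemma hcoeff_uminus [simp]: "hcoeff (- f) e = - hcoeff f e"
  unfolding uminus_hahn_def
  by (subst hcoeff_Abs[OF wo_hsupp[of f]]) (auto simp: hsupp_def)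

lemma hcoeff_mult:
  "hcoeff (f * g) e = (\<Sum>(a, b)\<in>sum_pairs (hsupp f) (hsupp g) e. hcoeff f a * hcoeff g b)"
  unfolding times_hahn_def
proof (subst hcoeff_Abs[OF wo_real_plus[OF wo_hsupp[of f] wo_hsupp[of g]]])
  fix e assume "e \<notin> set_plus_real (hsupp f) (hsupp g)"
  then have "sum_pairs (hsupp f) (hsupp g) e = {}"
    unfolding set_plus_real_def sum_pairs_def by blast
  then show "(\<Sum>(a, b)\<in>sum_pairs (hsupp f) (hsupp g) e. hcoeff f a * hcoeff g b) = 0" by simp
qed simp

lemma hsupp_mult: "hsupp (f * g) \<subseteq> set_plus_real (hsupp f) (hsupp g)"
proof
  fix e assume "e \<in> hsupp (f * g)"
  then have "sum_pairs (hsupp f) (hsupp g) e \<noteq> {}"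
    by (auto simp: hsupp_def hcoeff_mult simp del: Collect_empty_eq)
  then show "e \<in> set_plus_real (hsupp f) (hsupp g)"
    unfolding set_plus_real_def sum_pairs_def by blast
qed

lemma hcoeff_mult_superset:
  assumes "wfp_on A (<)" "wfp_on B (<)" "hsupp f \<subseteq> A" "hsupp g \<subseteq> B"
  shows "hcoeff (f * g) e = (\<Sum>(a, b)\<in>sum_pairs A B e. hcoeff f a * hcoeff g b)"
  unfolding hcoeff_mult
proof (rule sum.mono_neutral_left)
  show "finite (sum_pairs A B e)" by (rule finite_sum_pairs[OF assms(1,2)])
  show "sum_pairs (hsupp f) (hsupp g) e \<subseteq> sum_pairs A B e"
    using assms(3,4) by (auto simp: sum_pairs_def)
  show "\<forall>i\<in>sum_pairs A B e - sum_pairs (hsupp f) (hsupp g) e.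
      (case i of (a, b) \<Rightarrow> hcoeff f a * hcoeff g b) = 0"
    by (auto simp: sum_pairs_def hsupp_def)
qed

lemma hahn_mult_commute: "f * g = g * (f::hahn)"
proof (rule hahn_eqI)
  fix e
  show "hcoeff (f * g) e = hcoeff (g * f) e"
    unfolding hcoeff_mult
    by (rule sum.reindex_bij_witness[of _ prod.swap prod.swap]) (auto simp: sum_pairs_def)
qed

lemma hahn_add_mult: "(f + g) * h = f * h + g * (h::hahn)"
proof (rule hahn_eqI)
  fix e
  have W: "wfp_on (hsupp f \<union> hsupp g) (<)" by (rule wo_real_Un[OF wo_hsupp wo_hsupp])
  have S: "hsupp (f + g) \<subseteq> hsupp f \<union> hsupp g" by (auto simp: hsupp_def)
  have "hcoeff ((f + g) * h) e =
      (\<Sum>(a, b)\<in>sum_pairs (hsupp f \<union> hsupp g) (hsupp h) e. hcoeff (f + g) a * hcoeff h b)"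
    by (rule hcoeff_mult_superset[OF W wo_hsupp S order_refl])
  also have "\<dots> =
      (\<Sum>p\<in>sum_pairs (hsupp f \<union> hsupp g) (hsupp h) e.
        (case p of (a, b) \<Rightarrow> hcoeff f a * hcoeff h b) + (case p of (a, b) \<Rightarrow> hcoeff g a * hcoeff h b))"
    by (rule sum.cong) (auto simp: distrib_right)
  also have "\<dots> = hcoeff (f * h) e + hcoeff (g * h) e"
    by (simp only: sum.distrib hcoeff_mult_superset[OF W wo_hsupp Un_upper1 order_refl]
          hcoeff_mult_superset[OF W wo_hsupp Un_upper2 order_refl])
  finally show "hcoeff ((f + g) * h) e = hcoeff (f * h + g * h) e" by simp
qed

lemma hahn_mult_assoc: "(f * g) * h = f * (g * (h::hahn))"
proof (rule hahn_eqI)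
  fix e
  let ?F = "hsupp f" and ?G = "hsupp g" and ?H = "hsupp h"
  have FG: "wfp_on (set_plus_real ?F ?G) (<)" by (rule wo_real_plus[OF wo_hsupp wo_hsupp])
  have GH: "wfp_on (set_plus_real ?G ?H) (<)" by (rule wo_real_plus[OF wo_hsupp wo_hsupp])
  let ?L = "Sigma (sum_pairs (set_plus_real ?F ?G) ?H e) (\<lambda>(d, c). sum_pairs ?F ?G d)"
  let ?R = "Sigma (sum_pairs ?F (set_plus_real ?G ?H) e) (\<lambda>(a, d). sum_pairs ?G ?H d)"
  have "hcoeff ((f * g) * h) e =
      (\<Sum>(d, c)\<in>sum_pairs (set_plus_real ?F ?G) ?H e. hcoeff (f * g) d * hcoeff h c)"
    by (rule hcoeff_mult_superset[OF FG wo_hsupp hsupp_mult order_refl])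
  also have "\<dots> = (\<Sum>p\<in>sum_pairs (set_plus_real ?F ?G) ?H e.
      \<Sum>q\<in>(case p of (d, c) \<Rightarrow> sum_pairs ?F ?G d). hcoeff f (fst q) * hcoeff g (snd q) * hcoeff h (snd p))"
    by (simp add: hcoeff_mult case_prod_unfold sum_distrib_right)
  also have "\<dots> = (\<Sum>(p, q)\<in>?L. hcoeff f (fst q) * hcoeff g (snd q) * hcoeff h (snd p))"
    by (rule sum.Sigma) (auto intro!: finite_sum_pairs FG wo_hsupp)
  also have "\<dots> = (\<Sum>(p, q)\<in>?R. hcoeff f (fst p) * (hcoeff g (fst q) * hcoeff h (snd q)))"
    by (rule sum.reindex_bij_witness[of _
          "\<lambda>(p, q). ((fst p + fst q, snd q), (fst p, fst q))"
          "\<lambda>(p, q). ((fst q, snd q + snd p), (snd q, snd p))"])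
       (auto simp: sum_pairs_def intro: set_plus_realI)
  also have "\<dots> = (\<Sum>p\<in>sum_pairs ?F (set_plus_real ?G ?H) e.
      \<Sum>q\<in>(case p of (a, d) \<Rightarrow> sum_pairs ?G ?H d). hcoeff f (fst p) * (hcoeff g (fst q) * hcoeff h (snd q)))"
    by (rule sum.Sigma[symmetric]) (auto intro!: finite_sum_pairs GH wo_hsupp)
  also have "\<dots> = (\<Sum>(a, d)\<in>sum_pairs ?F (set_plus_real ?G ?H) e. hcoeff f a * hcoeff (g * h) d)"
    by (simp add: hcoeff_mult case_prod_unfold sum_distrib_left)
  also have "\<dots> = hcoeff (f * (g * h)) e"
    by (rule hcoeff_mult_superset[OF wo_hsupp GH order_refl hsupp_mult, symmetric])
  finally show "hcoeff ((f * g) * h) e = hcoeff (f * (g * h)) e" .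
qed

lemma hsupp_monom: "hsupp (hmonom c v) \<subseteq> {v}"
  by (auto simp: hsupp_def hcoeff_monom split: if_splits)

lemma hcoeff_monom_mult: "hcoeff (hmonom c v * f) e = c * hcoeff f (e - v)"
proof -
  have "hcoeff (hmonom c v * f) e =
      (\<Sum>(a, b)\<in>sum_pairs {v} (insert (e - v) (hsupp f)) e. hcoeff (hmonom c v) a * hcoeff f b)"
    by (rule hcoeff_mult_superset)
       (auto simp: wo_real_singleton hsupp_monom wo_real_insert wo_hsupp)
  also have "sum_pairs {v} (insert (e - v) (hsupp f)) e = {(v, e - v)}"
    by (auto simp: sum_pairs_def)
  finally show ?thesis by (simp add: hcoeff_monom)
qed

instance hahn :: comm_ring_1
proof
  fix a b c :: hahn
  show "a * b * c = a * (b * c)" by (rule hahn_mult_assoc)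
  show "a * b = b * a" by (rule hahn_mult_commute)
  show "(a + b) * c = a * c + b * c" by (rule hahn_add_mult)
  show "1 * a = a" by (rule hahn_eqI) (simp add: one_hahn_def hcoeff_monom_mult)
  show "(0::hahn) \<noteq> 1" by (metis hcoeff_0 hcoeff_1 zero_neq_one)
qed (auto intro!: hahn_eqI)

lemma hcoeff_sum: "hcoeff (sum F I) e = (\<Sum>i\<in>I. hcoeff (F i) e)"
  by (induction I rule: infinite_finite_induct) auto

lemma hmonom_mult: "hmonom c v * hmonom d w = hmonom (c * d) (v + w)"
  by (rule hahn_eqI) (auto simp: hcoeff_monom_mult hcoeff_monom)

lemma hahn_lowest:
  assumes "f \<noteq> 0"
  obtains v where "hcoeff f v \<noteq> 0" "\<And>e. hcoeff f e \<noteq> 0 \<Longrightarrow> v \<le> e"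
proof -
  have "hsupp f \<noteq> {}" using assms by (auto simp: hsupp_def intro: hahn_eqI)
  then obtain v where "v \<in> hsupp f" "\<And>x. x \<in> hsupp f \<Longrightarrow> v \<le> x"
    using wo_real_min[OF wo_hsupp order_refl, of f] by blast
  then show ?thesis using that by (auto simp: hsupp_def)
qed

lemma hcoeff_mult_below:
  assumes "\<And>e. e < a \<Longrightarrow> hcoeff f e = 0" "\<And>e. e < b \<Longrightarrow> hcoeff g e = 0" "e < a + b"
  shows "hcoeff (f * g) e = 0"
  unfolding hcoeff_mult
proof (intro sum.neutral ballI, clarify)
  fix x y assume "(x, y) \<in> sum_pairs (hsupp f) (hsupp g) e"
  then have "x + y = e" by (simp add: sum_pairs_def)
  then have "x < a \<or> y < b" using assms(3) by linarith
  then show "hcoeff f x * hcoeff g y = 0" using assms(1,2) by auto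
qed

lemma hcoeff_mult_cong:
  assumes "\<And>x. x < 0 \<Longrightarrow> hcoeff u x = 0" "\<And>x. x \<le> e \<Longrightarrow> hcoeff f x = hcoeff g x"
  shows "hcoeff (u * f) e = hcoeff (u * g) e"
proof -
  have "hcoeff (u * (f - g)) e = 0"
    unfolding hcoeff_mult
  proof (intro sum.neutral ballI, clarify)
    fix x y assume "(x, y) \<in> sum_pairs (hsupp u) (hsupp (f - g)) e"
    then have "x + y = e" by (simp add: sum_pairs_def)
    then have "x < 0 \<or> y \<le> e" by linarith
    then show "hcoeff u x * hcoeff (f - g) y = 0" using assms by auto
  qed
  then show ?thesis by (simp add: right_diff_distrib)
qed

lemma hcoeff_power_below:
  assumes "\<And>e. e < m \<Longrightarrow> hcoeff g e = 0" "e < real n * m"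
  shows "hcoeff (g ^ n) e = 0"
  using assms(2)
proof (induction n arbitrary: e)
  case 0 then show ?case by (simp add: hcoeff_1)
next
  case (Suc n)
  have "e < m + real n * m" using Suc.prems by (simp add: algebra_simps)
  then show ?case using hcoeff_mult_below[of m g "real n * m" "g ^ n" e] assms(1) Suc.IH by simp
qed

text \<open>The geometric series: since the exponents are real (so the value group is Archimedean),
  each coefficient of \<open>\<Sum>n. g ^ n\<close> is a finite sum.\<close>

lemma hahn_geometric:
  assumes g: "\<And>e. e < m \<Longrightarrow> hcoeff g e = 0" and m: "m > 0"
  shows "\<exists>s. (1 - g) * s = (1::hahn)"
proof -
  define P where "P M = (\<Sum>n<M. g ^ n)" for M
  obtain N :: "real \<Rightarrow> nat" where N: "\<And>e. e < real (N e) * m"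
    using ex_less_of_nat_mult[OF m] by metis
  have stab: "hcoeff (P K) e = hcoeff (P M) e" if "e < real M * m" "M \<le> K" for e K M
  proof -
    have "(\<Sum>n<K. hcoeff (g ^ n) e) = (\<Sum>n<M. hcoeff (g ^ n) e)"
    proof (rule sum.mono_neutral_right)
      show "\<forall>n\<in>{..<K} - {..<M}. hcoeff (g ^ n) e = 0"
      proof
        fix n assume "n \<in> {..<K} - {..<M}"
        then have "real M * m \<le> real n * m" using m by (simp add: mult_right_mono)
        then show "hcoeff (g ^ n) e = 0" using hcoeff_power_below[OF g] that(1) by simp
      qed
    qed (use that in auto)
    then show ?thesis by (simp add: P_def hcoeff_sum)
  qed
  define S where "S e = hcoeff (P (N e)) e" for e
  have SP: "S e = hcoeff (P M) e" if "e < real M * m" for e M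
    using stab[OF that, of "max M (N e)"] stab[OF N, of e "max M (N e)"] by (simp add: S_def)
  have "wfp_on {e. S e \<noteq> 0} (<)"
    unfolding wo_real_iff
  proof (intro allI impI)
    fix T assume T: "T \<subseteq> {e. S e \<noteq> 0}" "T \<noteq> {}"
    then obtain t where t: "t \<in> T" by blast
    have "T \<inter> {..t} \<subseteq> hsupp (P (N t))"
    proof
      fix e assume e: "e \<in> T \<inter> {..t}"
      then have "e < real (N t) * m" using N[of t] by simp
      then show "e \<in> hsupp (P (N t))" using SP[of e "N t"] e T(1) by (auto simp: hsupp_def)
    qed
    moreover have "T \<inter> {..t} \<noteq> {}" using t by auto
    ultimately obtain z where z: "z \<in> T \<inter> {..t}" "\<And>x. x \<in> T \<inter> {..t} \<Longrightarrow> z \<le> x"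
      using wo_real_min[OF wo_hsupp] by blast
    have "\<forall>x\<in>T. z \<le> x"
    proof
      fix x assume "x \<in> T"
      then show "z \<le> x" using z by (cases "x \<le> t") auto
    qed
    then show "\<exists>z\<in>T. \<forall>x\<in>T. z \<le> x" using z(1) by blast
  qed
  then have cS: "hcoeff (Abs_hahn S) = S" by (simp add: Abs_hahn_inverse)
  have "(1 - g) * Abs_hahn S = 1"
  proof (rule hahn_eqI)
    fix e
    have "hcoeff ((1 - g) * Abs_hahn S) e = hcoeff ((1 - g) * P (N e)) e"
    proof (rule hcoeff_mult_cong)
      show "hcoeff (1 - g) x = 0" if "x < 0" for x
        using that g m by (simp add: hcoeff_1)
      show "hcoeff (Abs_hahn S) x = hcoeff (P (N e)) x" if "x \<le> e" for x
        using SP[of x "N e"] N[of e] that cS by simp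
    qed
    also have "(1 - g) * P (N e) = 1 - g ^ N e"
      by (simp add: P_def one_diff_power_eq)
    also have "hcoeff (1 - g ^ N e) e = hcoeff 1 e"
      using hcoeff_power_below[OF g N] by simp
    finally show "hcoeff ((1 - g) * Abs_hahn S) e = hcoeff 1 e" .
  qed
  then show ?thesis by blast
qed

lemma hahn_right_inverse:
  assumes "f \<noteq> 0"
  shows "\<exists>g. f * g = (1::hahn)"
proof -
  obtain v where v: "hcoeff f v \<noteq> 0" "\<And>e. hcoeff f e \<noteq> 0 \<Longrightarrow> v \<le> e"
    using hahn_lowest[OF assms] by blast
  define u where "u = hmonom (inverse (hcoeff f v)) (- v)"
  define g where "g = 1 - u * f"
  have cg: "hcoeff g e = (if e = 0 then 1 else 0) - inverse (hcoeff f v) * hcoeff f (e + v)" for e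
    by (simp add: g_def u_def hcoeff_1 hcoeff_monom_mult)
  have pos: "e > 0" if "hcoeff g e \<noteq> 0" for e
    using that v(1) v(2)[of "e + v"] by (cases "e = 0") (auto simp: cg)
  have "\<exists>s. (1 - g) * s = 1"
  proof (cases "g = 0")
    case True then show ?thesis by simp
  next
    case False
    then obtain m where m: "hcoeff g m \<noteq> 0" "\<And>e. hcoeff g e \<noteq> 0 \<Longrightarrow> m \<le> e"
      using hahn_lowest by blast
    then show ?thesis using hahn_geometric[of m g] pos[of m] by force
  qed
  then obtain s where "u * f * s = 1" by (auto simp: g_def)
  then have "f * (u * s) = 1" by (simp add: ac_simps)
  then show ?thesis by blast
qed

instance hahn :: field
proof
  fix a b :: hahn
  show "inverse a * a = 1" if a: "a \<noteq> 0"
  proof -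
    obtain g where g: "a * g = 1" using hahn_right_inverse[OF a] by blast
    have "(THE h. a * h = 1) = g"
    proof (rule the_equality)
      show "a * g = 1" by (rule g)
      fix h assume "a * h = 1"
      then show "h = g" by (metis g mult.assoc mult.commute mult_1)
    qed
    then show ?thesis using a g by (simp add: inverse_hahn_def mult.commute)
  qed
  show "a div b = a * inverse b" by (rule divide_hahn_def)
  show "inverse (0::hahn) = 0" by (simp add: inverse_hahn_def)
qed

definition hdeg :: "hahn \<Rightarrow> ereal" where
  "hdeg f = (if f = 0 then \<infinity> else ereal (LEAST e. hcoeff f e \<noteq> 0))"

lemma hdeg_eq_iff:
  "hdeg f = ereal v \<longleftrightarrow> hcoeff f v \<noteq> 0 \<and> (\<forall>e<v. hcoeff f e = 0)"
proof (cases "f = 0")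
  case False
  then obtain w where w: "hcoeff f w \<noteq> 0" "\<And>e. hcoeff f e \<noteq> 0 \<Longrightarrow> w \<le> e"
    using hahn_lowest by blast
  then have "(LEAST e. hcoeff f e \<noteq> 0) = w" by (rule Least_equality)
  then have "hdeg f = ereal w" using False by (simp add: hdeg_def)
  moreover have "w = v \<longleftrightarrow> hcoeff f v \<noteq> 0 \<and> (\<forall>e<v. hcoeff f e = 0)"
    using w by (metis linorder_neqE not_le)
  ultimately show ?thesis by simp
qed (simp add: hdeg_def)


section \<open>Tropical and Kapranov rank\<close>

text \<open>The minimum over all permutations of \<open>{..<r}\<close> is attained exactly once.\<close>

definition tropically_nonsingular :: "nat \<Rightarrow> real mat \<Rightarrow> bool" where
  "tropically_nonsingular r S \<longleftrightarrow>
     (\<exists>!\<sigma>. is_arg_min (\<lambda>\<sigma>. \<Sum>i<r. S $$ (i, \<sigma> i)) (\<lambda>\<sigma>. \<sigma> permutes {..<r}) \<sigma>)"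

definition tropical_minor_sizes :: "real mat \<Rightarrow> nat set" where
  "tropical_minor_sizes A = {r. \<exists>I J. I \<subseteq> {..<dim_row A} \<and> J \<subseteq> {..<dim_col A} \<and>
     card I = r \<and> card J = r \<and> tropically_nonsingular r (submatrix A I J)}"

definition tropical_rank :: "real mat \<Rightarrow> nat" where
  "tropical_rank A = Max (tropical_minor_sizes A)"

lemma finite_tropical_minor_sizes: "finite (tropical_minor_sizes A)"
proof (rule finite_subset)
  show "tropical_minor_sizes A \<subseteq> {..dim_row A}"
    unfolding tropical_minor_sizes_def
    by (auto dest!: card_mono[OF finite_lessThan])
qed simp

lemma zero_in_tropical_minor_sizes: "0 \<in> tropical_minor_sizes A"
  unfolding tropical_minor_sizes_def tropically_nonsingular_def
  by (auto simp: is_arg_min_def intro!: exI[of _ "{}"] ex1I[of _ id])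

definition kapranov_rank :: "real mat \<Rightarrow> nat" where
  "kapranov_rank B = (LEAST r. \<exists>A :: hahn mat. A \<in> carrier_mat (dim_row B) (dim_col B) \<and>
     (\<forall>i<dim_row B. \<forall>j<dim_col B. hdeg (A $$ (i, j)) = ereal (B $$ (i, j))) \<and>
     vec_space.rank (dim_row B) A = r)"

lemma kapranov_lift_exists:
  "\<exists>A :: hahn mat. A \<in> carrier_mat (dim_row B) (dim_col B) \<and>
     (\<forall>i<dim_row B. \<forall>j<dim_col B. hdeg (A $$ (i, j)) = ereal (B $$ (i, j)))"
  by (rule exI[of _ "mat (dim_row B) (dim_col B) (\<lambda>ij. hmonom 1 (B $$ ij))"])
     (simp add: hdeg_eq_iff hcoeff_monom)

end

theory Submission
  imports Defs
begin

text \<open>Border \<open>A\<close> by a row and a column with constant entry \<open>P\<close> and put \<open>0\<close> in the corner, where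
  \<open>2 P\<close> exceeds every entry of \<open>A\<close>. A minimal matching using both the last row and the last column
  must match them with each other, since otherwise an exchange lowers the weight; hence nonsingular
  minors of \<open>B\<close> are at most one larger than those of \<open>A\<close>, and bordering a nonsingular minor of \<open>A\<close>
  gives one of \<open>B\<close>. In a lift of \<open>B\<close>, eliminating with the corner entry changes the entries of the
  \<open>A\<close>-block only in degrees at least \<open>2 P\<close>, so the Schur complement is a lift of \<open>A\<close>, of rank one
  less.\<close>

section \<open>Tropical rank\<close>

text \<open>Keeping the row set \<open>I\<close> and column set \<open>J\<close> explicit lets
  indices be added or deleted without renumbering, which \<open>submatrix\<close> would force.
  Competitors are compared with \<open>f\<close> on \<open>I\<close> only, so values outside
  \<open>I\<close> are free.\<close>

definition unique_min_matching ::
    "('i \<Rightarrow> 'j \<Rightarrow> real) \<Rightarrow> 'i set \<Rightarrow> 'j set \<Rightarrow> ('i \<Rightarrow> 'j) \<Rightarrow> bool" where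
  "unique_min_matching a I J f \<longleftrightarrow> bij_betw f I J \<and>
     (\<forall>g. bij_betw g I J \<and> (\<exists>i\<in>I. g i \<noteq> f i) \<longrightarrow> (\<Sum>i\<in>I. a i (f i)) < (\<Sum>i\<in>I. a i (g i)))"

lemma unique_min_matching_bij: "unique_min_matching a I J f \<Longrightarrow> bij_betw f I J"
  by (simp add: unique_min_matching_def)

lemma unique_min_matching_less:
  "\<lbrakk>unique_min_matching a I J f; bij_betw g I J; i \<in> I; g i \<noteq> f i\<rbrakk>
    \<Longrightarrow> (\<Sum>i\<in>I. a i (f i)) < (\<Sum>i\<in>I. a i (g i))"
  unfolding unique_min_matching_def by blast

lemma unique_min_matching_le:
  assumes "unique_min_matching a I J f" "bij_betw g I J"
  shows "(\<Sum>i\<in>I. a i (f i)) \<le> (\<Sum>i\<in>I. a i (g i))"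
proof (cases "\<exists>i\<in>I. g i \<noteq> f i")
  case True
  then show ?thesis using unique_min_matching_less[OF assms] by fastforce
next
  case False
  then have "(\<Sum>i\<in>I. a i (f i)) = (\<Sum>i\<in>I. a i (g i))" by (intro sum.cong) auto
  then show ?thesis by simp
qed

text \<open>Uniqueness of the minimum survives relabelling of rows by \<open>p\<close> and columns
  by \<open>q\<close>: a competitor \<open>g\<close> between \<open>I\<close> and \<open>J\<close>
  pulls back to one between \<open>K\<close> and \<open>L\<close> of the same weight, and the two
  disagree with their reference matchings at corresponding indices.\<close>

lemma unique_min_matching_reindex:
  assumes p: "bij_betw p K I" and q: "bij_betw q L J"
    and f: "unique_min_matching (\<lambda>i j. a (p i) (q j)) K L f"
  shows "unique_min_matching a I J (q \<circ> f \<circ> inv_into K p)"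
proof -
  let ?p = "inv_into K p" and ?q = "inv_into L q"
  have p': "bij_betw ?p I K" and q': "bij_betw ?q J L"
    using p q by (auto intro: bij_betw_inv_into)
  have pp: "\<And>i. i \<in> K \<Longrightarrow> ?p (p i) = i" and pp': "\<And>i. i \<in> I \<Longrightarrow> p (?p i) = i"
    using p by (auto simp: bij_betw_inv_into_left bij_betw_inv_into_right)
  have qq: "\<And>j. j \<in> J \<Longrightarrow> q (?q j) = j"
    using q by (auto simp: bij_betw_inv_into_right)
  have sumI: "(\<Sum>i\<in>I. F i) = (\<Sum>k\<in>K. F (p k))" for F :: "_ \<Rightarrow> real"
    by (rule sum.reindex_bij_betw[OF p, symmetric])
  show ?thesis
    unfolding unique_min_matching_def
  proof (intro conjI allI impI)
    show "bij_betw (q \<circ> f \<circ> ?p) I J"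
      using p' q unique_min_matching_bij[OF f] by (auto intro: bij_betw_trans)
    fix g assume g: "bij_betw g I J \<and> (\<exists>i\<in>I. g i \<noteq> (q \<circ> f \<circ> ?p) i)"
    then obtain i where i: "i \<in> I" "g i \<noteq> q (f (?p i))" by auto
    define h where "h = ?q \<circ> (g \<circ> p)"
    have h: "bij_betw h K L" using g p q' unfolding h_def by (auto intro: bij_betw_trans)
    have gJ: "g i \<in> J" if "i \<in> I" for i using g that by (auto simp: bij_betw_def)
    have pI: "p k \<in> I" if "k \<in> K" for k using p that by (auto simp: bij_betw_def)
    have qh: "q (h k) = g (p k)" if "k \<in> K" for k
      using that gJ pI by (simp add: h_def qq)
    have iK: "?p i \<in> K" using p' i(1) by (auto simp: bij_betw_def)
    have "h (?p i) \<noteq> f (?p i)" using qh[OF iK] i pp' by auto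
    then have "(\<Sum>k\<in>K. a (p k) (q (f k))) < (\<Sum>k\<in>K. a (p k) (q (h k)))"
      using unique_min_matching_less[OF f h iK] by simp
    then show "(\<Sum>i\<in>I. a i ((q \<circ> f \<circ> ?p) i)) < (\<Sum>i\<in>I. a i (g i))"
      by (simp add: sumI qh pp)
  qed
qed

lemma bij_betw_pick:
  assumes "finite I"
  shows "bij_betw (pick I) {..<card I} I"
proof -
  have "inj_on (pick I) {..<card I}"
    by (rule strict_mono_on_imp_inj_on) (auto simp: strict_mono_on_def intro: pick_mono_le)
  moreover have "pick I ` {..<card I} \<subseteq> I" using pick_in_set_le by auto
  ultimately show ?thesis
    by (simp add: bij_betw_def assms card_image card_subset_eq)
qed

text \<open>A permutation of \<open>{..<k}\<close> is the identity outside that set, whereas a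
  matching is unconstrained there. Extending a matching by the identity keeps its weight and turns
  agreement on \<open>{..<k}\<close> into equality of functions.\<close>

lemma tropically_nonsingular_iff:
  "tropically_nonsingular k S \<longleftrightarrow>
     (\<exists>f. unique_min_matching (\<lambda>i j. S $$ (i, j)) {..<k} {..<k} f)"
proof
  let ?w = "\<lambda>\<sigma>. \<Sum>i<k. S $$ (i, \<sigma> i)"
  let ?ext = "\<lambda>g i. if i < k then g i else i"
  have ext: "?ext g permutes {..<k}" if "bij_betw g {..<k} {..<k}" for g
    by (rule bij_imp_permutes) (use bij_betw_cong[of "{..<k}" g "?ext g" "{..<k}"] that in auto)
  have w_ext: "?w (?ext g) = ?w g" for g by (rule sum.cong) auto
  {
    assume "tropically_nonsingular k S"
    then obtain \<sigma> where \<sigma>: "is_arg_min ?w (\<lambda>\<sigma>. \<sigma> permutes {..<k}) \<sigma>"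
      and uniq: "\<And>\<tau>. is_arg_min ?w (\<lambda>\<sigma>. \<sigma> permutes {..<k}) \<tau> \<Longrightarrow> \<tau> = \<sigma>"
      unfolding tropically_nonsingular_def by blast
    have "unique_min_matching (\<lambda>i j. S $$ (i, j)) {..<k} {..<k} \<sigma>"
      unfolding unique_min_matching_def
    proof (intro conjI allI impI)
      show "bij_betw \<sigma> {..<k} {..<k}" using \<sigma> permutes_imp_bij by (auto simp: is_arg_min_def)
      fix g assume g: "bij_betw g {..<k} {..<k} \<and> (\<exists>i\<in>{..<k}. g i \<noteq> \<sigma> i)"
      \<comment> \<open>The extension of \<open>g\<close> is a permutation other than the only
        minimiser, so some permutation is strictly lighter than it, and \<sigma> is at most as heavy
        as that one.\<close>
      then have "?ext g \<noteq> \<sigma>" by (auto simp: fun_eq_iff)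
      then have "\<not> is_arg_min ?w (\<lambda>\<sigma>. \<sigma> permutes {..<k}) (?ext g)" using uniq by blast
      then obtain \<tau> where "\<tau> permutes {..<k}" "?w \<tau> < ?w g"
        using ext[of g] g unfolding is_arg_min_def w_ext by auto
      then show "?w \<sigma> < ?w g" using \<sigma> unfolding is_arg_min_def by (meson not_less order_less_le_trans order_le_less_trans)
    qed
    then show "\<exists>f. unique_min_matching (\<lambda>i j. S $$ (i, j)) {..<k} {..<k} f" by blast
  }
  assume "\<exists>f. unique_min_matching (\<lambda>i j. S $$ (i, j)) {..<k} {..<k} f"
  then obtain f where f: "unique_min_matching (\<lambda>i j. S $$ (i, j)) {..<k} {..<k} f" ..
  have pf: "?ext f permutes {..<k}" using ext unique_min_matching_bij[OF f] by blast
  show "tropically_nonsingular k S"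
    unfolding tropically_nonsingular_def
  proof (rule ex1I[of _ "?ext f"])
    show "is_arg_min ?w (\<lambda>\<sigma>. \<sigma> permutes {..<k}) (?ext f)"
      unfolding is_arg_min_def w_ext
      using pf unique_min_matching_le[OF f permutes_imp_bij] by (auto simp: not_less)
    fix \<tau> assume \<tau>: "is_arg_min ?w (\<lambda>\<sigma>. \<sigma> permutes {..<k}) \<tau>"
    then have p: "\<tau> permutes {..<k}" by (simp add: is_arg_min_def)
    have "\<not> ?w f < ?w \<tau>" using \<tau> pf w_ext[of f] unfolding is_arg_min_def by metis
    then have eq: "\<tau> i = f i" if "i < k" for i
      using unique_min_matching_less[OF f permutes_imp_bij[OF p], of i] that by auto
    show "\<tau> = ?ext f"
    proof
      fix i show "\<tau> i = ?ext f i"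
        using eq[of i] permutes_not_in[OF p, of i] by simp
    qed
  qed
qed

text \<open>The maps \<open>pick I\<close> and \<open>pick J\<close> enumerate the chosen rows and
  columns, so the submatrix is a relabelling of the entries of \<open>A\<close> over
  \<open>I\<close> and \<open>J\<close>. From here on, minors are treated as pairs of index sets of
  \<open>A\<close> itself.\<close>

lemma tropically_nonsingular_submatrix_iff:
  assumes "I \<subseteq> {..<dim_row A}" "J \<subseteq> {..<dim_col A}" "card I = k" "card J = k"
  shows "tropically_nonsingular k (submatrix A I J) \<longleftrightarrow>
    (\<exists>f. unique_min_matching (\<lambda>i j. A $$ (i, j)) I J f)"
proof -
  have fin: "finite I" "finite J" using assms finite_subset by blast+
  have p: "bij_betw (pick I) {..<k} I" and q: "bij_betw (pick J) {..<k} J"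
    using bij_betw_pick fin assms(3,4) by metis+
  have sets: "{i. i < dim_row A \<and> i \<in> I} = I" "{j. j < dim_col A \<and> j \<in> J} = J"
    using assms by auto
  have entry: "submatrix A I J $$ (i, j) = A $$ (pick I i, pick J j)" if "i < k" "j < k" for i j
    using that assms submatrix_index[of i A I j J] sets by simp
  let ?a = "\<lambda>i j. A $$ (pick I i, pick J j)"
  have "unique_min_matching (\<lambda>i j. submatrix A I J $$ (i, j)) {..<k} {..<k} f \<longleftrightarrow>
      unique_min_matching ?a {..<k} {..<k} f" for f
  proof -
    have "(\<Sum>i<k. submatrix A I J $$ (i, g i)) = (\<Sum>i<k. ?a i (g i))"
      if "bij_betw g {..<k} {..<k}" for g
      by (rule sum.cong) (use that entry in \<open>auto simp: bij_betw_def\<close>)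
    then show ?thesis unfolding unique_min_matching_def by auto
  qed
  moreover have "(\<exists>f. unique_min_matching ?a {..<k} {..<k} f) \<longleftrightarrow>
      (\<exists>f. unique_min_matching (\<lambda>i j. A $$ (i, j)) I J f)"
  proof
    assume "\<exists>f. unique_min_matching ?a {..<k} {..<k} f"
    then show "\<exists>f. unique_min_matching (\<lambda>i j. A $$ (i, j)) I J f"
      using unique_min_matching_reindex[OF p q, of "\<lambda>i j. A $$ (i, j)"] by blast
  next
    assume "\<exists>f. unique_min_matching (\<lambda>i j. A $$ (i, j)) I J f"
    then obtain f where f: "unique_min_matching (\<lambda>i j. A $$ (i, j)) I J f" ..
    \<comment> \<open>For the converse the relabelling runs backwards, so the weights on
      \<open>I\<close> and \<open>J\<close> are first written as \<open>?a\<close> composed with the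
      inverse enumerations.\<close>
    have "(\<Sum>i\<in>I. ?a (inv_into {..<k} (pick I) i) (inv_into {..<k} (pick J) (g i)))
        = (\<Sum>i\<in>I. A $$ (i, g i))" if "bij_betw g I J" for g
      by (rule sum.cong)
        (use that bij_betw_inv_into_right[OF p] bij_betw_inv_into_right[OF q] in \<open>auto simp: bij_betw_def\<close>)
    then have "unique_min_matching
        (\<lambda>i j. ?a (inv_into {..<k} (pick I) i) (inv_into {..<k} (pick J) j)) I J f"
      using f unfolding unique_min_matching_def by auto
    then show "\<exists>f. unique_min_matching ?a {..<k} {..<k} f"
      using unique_min_matching_reindex[OF bij_betw_inv_into[OF p] bij_betw_inv_into[OF q], of ?a]
      by blast
  qed
  ultimately show ?thesis by (simp add: tropically_nonsingular_iff)
qed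

text \<open>The condition on \<open>card J\<close> disappears because the matching itself is a
  bijection from \<open>I\<close> to \<open>J\<close>.\<close>

lemma tropical_minor_sizes_iff:
  "k \<in> tropical_minor_sizes A \<longleftrightarrow>
    (\<exists>I J f. I \<subseteq> {..<dim_row A} \<and> J \<subseteq> {..<dim_col A} \<and> card I = k \<and>
       unique_min_matching (\<lambda>i j. A $$ (i, j)) I J f)"
proof -
  have same: "card J = card I" if "unique_min_matching (\<lambda>i j. A $$ (i, j)) I J f" for I J f
    using bij_betw_same_card[OF unique_min_matching_bij[OF that]] by simp
  have "I \<subseteq> {..<dim_row A} \<and> J \<subseteq> {..<dim_col A} \<and> card I = k \<and> card J = k \<and>
      tropically_nonsingular k (submatrix A I J) \<longleftrightarrow>
      (\<exists>f. I \<subseteq> {..<dim_row A} \<and> J \<subseteq> {..<dim_col A} \<and> card I = k \<and>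
        unique_min_matching (\<lambda>i j. A $$ (i, j)) I J f)" for I J
    using tropically_nonsingular_submatrix_iff[of I A J k] same[of I J] by metis
  then show ?thesis by (simp only: tropical_minor_sizes_def mem_Collect_eq)
qed

lemma tropical_rank_eqI:
  assumes "k \<in> tropical_minor_sizes A" "\<And>l. l \<in> tropical_minor_sizes A \<Longrightarrow> l \<le> k"
  shows "tropical_rank A = k"
  unfolding tropical_rank_def using assms by (intro Max_eqI finite_tropical_minor_sizes) auto

section \<open>Insertion, deletion and exchange in minimal matchings\<close>

lemma bij_betw_insert_upd:
  assumes "bij_betw f I J" "i \<notin> I" "j \<notin> J"
  shows "bij_betw (f(i := j)) (insert i I) (insert j J)"
proof -
  have "bij_betw (f(i := j)) I J"
    using assms(1) by (rule iffD1[OF bij_betw_cong, rotated]) (use assms(2) in auto)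
  then show ?thesis
    using notIn_Un_bij_betw[of i I "f(i := j)" J] assms(2,3) by simp
qed

text \<open>Any competitor on the remaining indices extends by \<open>i \<mapsto> f i\<close> to a
  competitor on \<open>I\<close> and \<open>J\<close>; the common term \<open>a i (f i)\<close> then
  cancels.\<close>

lemma unique_min_matching_remove:
  assumes f: "unique_min_matching a I J f" and fin: "finite I" and i: "i \<in> I"
  shows "unique_min_matching a (I - {i}) (J - {f i}) f"
  unfolding unique_min_matching_def
proof (intro conjI allI impI)
  have bij: "bij_betw f I J" using f by (rule unique_min_matching_bij)
  show "bij_betw f (I - {i}) (J - {f i})"
    using bij i by (auto simp: bij_betw_def inj_on_def)
  fix g assume g: "bij_betw g (I - {i}) (J - {f i}) \<and> (\<exists>k\<in>I - {i}. g k \<noteq> f k)"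
  then obtain k where k: "k \<in> I" "k \<noteq> i" "g k \<noteq> f k" by blast
  let ?h = "g(i := f i)"
  have "bij_betw ?h (insert i (I - {i})) (insert (f i) (J - {f i}))"
    using g by (intro bij_betw_insert_upd) auto
  moreover have "insert i (I - {i}) = I" "insert (f i) (J - {f i}) = J"
    using bij i by (auto simp: bij_betw_def)
  ultimately have "bij_betw ?h I J" by simp
  then have "(\<Sum>i\<in>I. a i (f i)) < (\<Sum>i\<in>I. a i (?h i))"
    by (rule unique_min_matching_less[OF f _ k(1)]) (use k in simp)
  moreover have "(\<Sum>k\<in>I - {i}. a k (?h k)) = (\<Sum>k\<in>I - {i}. a k (g k))"
    by (rule sum.cong) auto
  ultimately show "(\<Sum>k\<in>I - {i}. a k (f k)) < (\<Sum>k\<in>I - {i}. a k (g k))"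
    using sum.remove[OF fin i, of "\<lambda>i. a i (f i)"] sum.remove[OF fin i, of "\<lambda>i. a i (?h i)"] by simp
qed

text \<open>Swapping the partners of \<open>i\<close> and \<open>k\<close> gives a different
  matching, since \<open>f\<close> is injective, and only these two terms of the weight
  change.\<close>

lemma unique_min_matching_exchange:
  assumes f: "unique_min_matching a I J f" and fin: "finite I"
    and ik: "i \<in> I" "k \<in> I" "i \<noteq> k"
  shows "a i (f i) + a k (f k) < a i (f k) + a k (f i)"
proof -
  have bij: "bij_betw f I J" using f by (rule unique_min_matching_bij)
  define g where "g = f \<circ> transpose i k"
  have "bij_betw g I J"
    unfolding g_def using permutes_imp_bij[OF permutes_swap_id[OF ik(1,2)]] bij
    by (rule bij_betw_trans)
  moreover have "g i \<noteq> f i"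
    using bij ik by (auto simp: g_def bij_betw_def inj_on_def)
  ultimately have less: "(\<Sum>i\<in>I. a i (f i)) < (\<Sum>i\<in>I. a i (g i))"
    using unique_min_matching_less[OF f] ik(1) by blast
  have split: "(\<Sum>i\<in>I. F i) = F i + F k + (\<Sum>i\<in>I - {i} - {k}. F i)" for F :: "_ \<Rightarrow> real"
    using sum.remove[OF fin ik(1), of F] sum.remove[of "I - {i}" k F] fin ik by simp
  have "(\<Sum>l\<in>I - {i} - {k}. a l (g l)) = (\<Sum>l\<in>I - {i} - {k}. a l (f l))"
    by (rule sum.cong) (auto simp: g_def transpose_def)
  then show ?thesis
    using less split[of "\<lambda>i. a i (f i)"] split[of "\<lambda>i. a i (g i)"] ik by (simp add: g_def)
qed

section \<open>The bordered matrix and its tropical rank\<close>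

definition bordered_mat :: "real \<Rightarrow> real mat \<Rightarrow> real mat" where
  "bordered_mat P A = mat (dim_row A + 1) (dim_col A + 1) (\<lambda>(i, j).
     if i < dim_row A \<and> j < dim_col A then A $$ (i, j)
     else if i = dim_row A \<and> j = dim_col A then 0 else P)"

lemma bordered_mat_dim [simp]:
  "dim_row (bordered_mat P A) = Suc (dim_row A)" "dim_col (bordered_mat P A) = Suc (dim_col A)"
  by (simp_all add: bordered_mat_def)

lemma bordered_mat_index [simp]:
  "i < dim_row A \<Longrightarrow> j < dim_col A \<Longrightarrow> bordered_mat P A $$ (i, j) = A $$ (i, j)"
  "i < dim_row A \<Longrightarrow> bordered_mat P A $$ (i, dim_col A) = P"
  "j < dim_col A \<Longrightarrow> bordered_mat P A $$ (dim_row A, j) = P"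
  "bordered_mat P A $$ (dim_row A, dim_col A) = 0"
  by (simp_all add: bordered_mat_def)

lemma unique_min_matching_bordered_inner:
  assumes "I \<subseteq> {..<dim_row A}" "J \<subseteq> {..<dim_col A}"
  shows "unique_min_matching (\<lambda>i j. bordered_mat P A $$ (i, j)) I J f \<longleftrightarrow>
    unique_min_matching (\<lambda>i j. A $$ (i, j)) I J f"
proof -
  have "(\<Sum>i\<in>I. bordered_mat P A $$ (i, g i)) = (\<Sum>i\<in>I. A $$ (i, g i))" if "bij_betw g I J" for g
    by (rule sum.cong) (use that assms in \<open>auto simp: bij_betw_def intro!: bordered_mat_index\<close>)
  then show ?thesis unfolding unique_min_matching_def by auto
qed

text \<open>Deleting at most one matched pair brings the minor inside \<open>A\<close>. If the last
  column is used, its pair is deleted; otherwise the pair of the last row, if there is one. The only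
  obstacle is a last row and a last column matched to different partners, which minimality
  excludes.\<close>

lemma tropical_minor_sizes_bordered_upper:
  assumes P: "\<And>i j. i < dim_row A \<Longrightarrow> j < dim_col A \<Longrightarrow> A $$ (i, j) < 2 * P"
    and k: "k \<in> tropical_minor_sizes (bordered_mat P A)"
  shows "\<exists>l\<in>tropical_minor_sizes A. k \<le> Suc l"
proof -
  let ?B = "bordered_mat P A" and ?d = "dim_row A" and ?n = "dim_col A"
  obtain I J f where I: "I \<subseteq> {..<Suc ?d}" and J: "J \<subseteq> {..<Suc ?n}" and card: "card I = k"
    and f: "unique_min_matching (\<lambda>i j. ?B $$ (i, j)) I J f"
    using k unfolding tropical_minor_sizes_iff by auto
  have fin: "finite I" using I finite_subset by blast
  have bij: "bij_betw f I J" using f by (rule unique_min_matching_bij)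
  have inner: "card I' \<in> tropical_minor_sizes A"
    if "I' \<subseteq> {..<?d}" "J' \<subseteq> {..<?n}" "unique_min_matching (\<lambda>i j. ?B $$ (i, j)) I' J' f" for I' J'
    unfolding tropical_minor_sizes_iff
    by (intro exI[of _ I'] exI[of _ J'] exI[of _ f])
      (use that unique_min_matching_bordered_inner[OF that(1,2)] in simp)
  have deleted: ?thesis if i: "i \<in> I" and "?d \<notin> I - {i}" "?n \<notin> J - {f i}" for i
  proof -
    have "card (I - {i}) \<in> tropical_minor_sizes A"
      using unique_min_matching_remove[OF f fin i] that I J by (intro inner) (auto simp: less_Suc_eq)
    then show ?thesis using card i fin by (intro bexI) auto
  qed
  show ?thesis
  proof (cases "?n \<in> J")
    case False
    show ?thesis
    proof (cases "?d \<in> I")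
      case True
      then show ?thesis using deleted[OF True] False by simp
    next
      case d: False
      then have "card I \<in> tropical_minor_sizes A"
        using f I J False by (intro inner) (auto simp: less_Suc_eq)
      then show ?thesis using card by (intro bexI[of _ k]) auto
    qed
  next
    case True
    then obtain i where i: "i \<in> I" "f i = ?n" using bij by (auto simp: bij_betw_def)
    have "?d \<notin> I - {i}"
    proof
      assume d: "?d \<in> I - {i}"
      have "i < ?d" using d i I by (auto simp: less_Suc_eq)
      moreover have "f ?d < ?n"
      proof -
        have "f ?d \<in> J" "f ?d \<noteq> f i" using d i(1) bij by (auto simp: bij_betw_def inj_on_def)
        then show ?thesis using i(2) J by (auto simp: less_Suc_eq)
      qed
      \<comment> \<open>Exchanging partners would trade two border entries \<open>P\<close> for the
        corner \<open>0\<close> and an entry of \<open>A\<close> below \<open>2 * P\<close>, so the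
        matching would not be minimal.\<close>
      ultimately show False
        using unique_min_matching_exchange[OF f fin i(1), of ?d] P[of i "f ?d"] d i by simp
    qed
    then show ?thesis using deleted[OF i(1)] i by simp
  qed
qed

text \<open>Competitors through the corner restrict to matchings between \<open>I\<close> and
  \<open>J\<close>, where \<open>f\<close> wins. A competitor that avoids the corner becomes
  strictly lighter when rerouted through it, so it loses as well.\<close>

lemma tropical_minor_sizes_bordered_lower:
  assumes P: "\<And>i j. i < dim_row A \<Longrightarrow> j < dim_col A \<Longrightarrow> A $$ (i, j) < 2 * P"
    and k: "k \<in> tropical_minor_sizes A"
  shows "Suc k \<in> tropical_minor_sizes (bordered_mat P A)"
proof -
  let ?B = "bordered_mat P A" and ?d = "dim_row A" and ?n = "dim_col A"
  obtain I J f where I: "I \<subseteq> {..<?d}" and J: "J \<subseteq> {..<?n}" and card: "card I = k"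
    and fA: "unique_min_matching (\<lambda>i j. A $$ (i, j)) I J f"
    using k unfolding tropical_minor_sizes_iff by auto
  have fin: "finite I" using I finite_subset by blast
  have notin: "?d \<notin> I" "?n \<notin> J" using I J by auto
  have f: "unique_min_matching (\<lambda>i j. ?B $$ (i, j)) I J f"
    using fA unique_min_matching_bordered_inner[OF I J] by blast
  let ?I = "insert ?d I" and ?J = "insert ?n J" and ?f = "f(?d := ?n)"
  let ?w = "\<lambda>g. \<Sum>i\<in>?I. ?B $$ (i, g i)"
  have upd: "bij_betw ?f ?I ?J"
    using bij_betw_insert_upd[OF unique_min_matching_bij[OF f] notin] .
  \<comment> \<open>The corner entry is \<open>0\<close>, so a matching through it weighs as much as
    its restriction to \<open>I\<close>.\<close>
  have w_corner: "?w g = (\<Sum>i\<in>I. ?B $$ (i, g i))" if "g ?d = ?n" for g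
    using that fin notin by simp
  have w_f: "?w ?f = (\<Sum>i\<in>I. ?B $$ (i, f i))"
    using w_corner[of ?f] notin by (auto intro: sum.cong)
  have restrict: "bij_betw g I J" if "bij_betw g ?I ?J" "g ?d = ?n" for g
  proof -
    have "bij_betw g (?I - {?d}) (?J - {?n})"
      using bij_betw_DiffI[OF that(1), of "{?d}" "{?n}"] that(2) by simp
    then show ?thesis using notin by simp
  qed
  have "unique_min_matching (\<lambda>i j. ?B $$ (i, j)) ?I ?J ?f"
    unfolding unique_min_matching_def
  proof (intro conjI allI impI upd)
    fix g assume g: "bij_betw g ?I ?J \<and> (\<exists>i\<in>?I. g i \<noteq> ?f i)"
    show "?w ?f < ?w g"
    proof (cases "g ?d = ?n")
      case True
      then obtain i where "i \<in> I" "g i \<noteq> f i" using g notin by (auto split: if_splits)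
      then show ?thesis
        unfolding w_f w_corner[of g, OF True]
        using unique_min_matching_less[OF f restrict] g True by blast
    next
      case False
      have "?n \<in> g ` ?I" using g by (auto simp: bij_betw_def)
      then obtain i where i: "i \<in> I" "g i = ?n" using False by auto
      have gd: "g ?d \<in> J" using g False by (auto simp: bij_betw_def)
      \<comment> \<open>\<open>h\<close> reroutes \<open>g\<close> through the corner: row
        \<open>?d\<close> takes the last column from row \<open>i\<close>, which receives
        \<open>g ?d\<close> in return.\<close>
      define h where "h = g \<circ> transpose i ?d"
      have h_simps: "h ?d = ?n" "h i = g ?d" using i by (auto simp: h_def)
      have "bij_betw h ?I ?J"
        unfolding h_def using permutes_imp_bij[OF permutes_swap_id[of i ?I ?d]] i(1) g
        by (intro bij_betw_trans[of _ ?I ?I]) auto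
      then have "?w ?f \<le> ?w h"
        unfolding w_f w_corner[of h, OF h_simps(1)]
        using unique_min_matching_le[OF f restrict] h_simps by blast
      \<comment> \<open>Only rows \<open>i\<close> and \<open>?d\<close> change: their contribution
        \<open>P + P\<close> becomes \<open>A $$ (i, g ?d) + 0\<close>.\<close>
      also have "?w h < ?w g"
      proof -
        have "(\<Sum>k\<in>I - {i}. ?B $$ (k, h k)) = (\<Sum>k\<in>I - {i}. ?B $$ (k, g k))"
          by (rule sum.cong) (use notin in \<open>auto simp: h_def transpose_def\<close>)
        moreover have "?w x = ?B $$ (?d, x ?d) + ?B $$ (i, x i) + (\<Sum>k\<in>I - {i}. ?B $$ (k, x k))" for x
          using fin notin i sum.remove[OF fin i(1), of "\<lambda>k. ?B $$ (k, x k)"] by simp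
        moreover have "i < ?d" "g ?d < ?n" using i gd I J by auto
        ultimately show ?thesis using h_simps i P[of i "g ?d"] by simp
      qed
      finally show ?thesis .
    qed
  qed
  moreover have "card ?I = Suc k" using fin notin card by simp
  moreover have "?I \<subseteq> {..<dim_row ?B}" "?J \<subseteq> {..<dim_col ?B}" using I J by auto
  ultimately show ?thesis unfolding tropical_minor_sizes_iff by blast
qed

lemma tropical_rank_bordered:
  assumes P: "\<And>i j. i < dim_row A \<Longrightarrow> j < dim_col A \<Longrightarrow> A $$ (i, j) < 2 * P"
  shows "tropical_rank (bordered_mat P A) = Suc (tropical_rank A)"
proof (rule tropical_rank_eqI)
  \<comment> \<open>The set of minor sizes is finite and contains \<open>0\<close>, so its maximum
    is attained.\<close>
  have "tropical_rank A \<in> tropical_minor_sizes A"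
    unfolding tropical_rank_def
    using finite_tropical_minor_sizes zero_in_tropical_minor_sizes by (intro Max_in) blast+
  then show "Suc (tropical_rank A) \<in> tropical_minor_sizes (bordered_mat P A)"
    using tropical_minor_sizes_bordered_lower P by blast
  fix k assume "k \<in> tropical_minor_sizes (bordered_mat P A)"
  then obtain l where "l \<in> tropical_minor_sizes A" "k \<le> Suc l"
    using tropical_minor_sizes_bordered_upper[of A P k] P by blast
  then show "k \<le> Suc (tropical_rank A)"
    unfolding tropical_rank_def using Max_ge[OF finite_tropical_minor_sizes] by fastforce
qed


section \<open>Kapranov rank\<close>

text \<open>Coefficients are attached to column indices rather than to column vectors, so two equal
  columns at different indices count as dependent. The library's \<open>lin_indpt\<close> speaks of
  sets of vectors, in which repetitions vanish; the next lemmas translate.\<close>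

definition indep_cols :: "'a::field mat \<Rightarrow> nat set \<Rightarrow> bool" where
  "indep_cols A J \<longleftrightarrow>
    (\<forall>x. (\<forall>i<dim_row A. (\<Sum>j\<in>J. x j * A $$ (i, j)) = 0) \<longrightarrow> (\<forall>j\<in>J. x j = 0))"

lemma indep_colsD:
  assumes "indep_cols A J" "\<And>i. i < dim_row A \<Longrightarrow> (\<Sum>j\<in>J. x j * A $$ (i, j)) = 0" "j \<in> J"
  shows "x j = 0"
  using assms unfolding indep_cols_def by blast

context vec_space
begin

lemma lincomb_cols_index:
  assumes "A \<in> carrier_mat n nc" "J \<subseteq> {..<nc}" "inj_on (col A) J" "i < n"
  shows "lincomb a (col A ` J) $ i = (\<Sum>j\<in>J. a (col A j) * A $$ (i, j))"
proof -
  have "col A ` J \<subseteq> carrier_vec n" using assms(1) by auto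
  then have "lincomb a (col A ` J) $ i = (\<Sum>j\<in>J. a (col A j) * col A j $ i)"
    using lincomb_index[OF assms(4)] sum.reindex[OF assms(3)] by simp
  also have "\<dots> = (\<Sum>j\<in>J. a (col A j) * A $$ (i, j))"
    by (rule sum.cong) (use assms in auto)
  finally show ?thesis .
qed

lemma card_indep_cols_le_rank:
  assumes A: "A \<in> carrier_mat n nc" and J: "J \<subseteq> {..<nc}" and ind: "indep_cols A J"
  shows "card J \<le> rank A"
proof -
  have fin: "finite J" using J finite_subset by blast
  have inj: "inj_on (col A) J"
  proof (rule inj_onI, rule ccontr)
    fix j k assume jk: "j \<in> J" "k \<in> J" "col A j = col A k" "j \<noteq> k"
    have nc: "j < nc" "k < nc" using jk J by auto
    have entries: "A $$ (i, j) = A $$ (i, k)" if "i < n" for i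
      using arg_cong[OF jk(3), of "\<lambda>v. v $ i"] that A nc by auto
    \<comment> \<open>Two equal columns would satisfy the relation with coefficients
      \<open>1\<close> and \<open>-1\<close>, contradicting independence; hence \<open>col A\<close>
      is injective on \<open>J\<close> and no cardinality is lost.\<close>
    define x where "x = (\<lambda>l. if l = j then 1 else if l = k then -1 else 0 :: 'a)"
    have "x j = 0"
    proof (rule indep_colsD[OF ind])
      fix i assume "i < dim_row A"
      have "(\<Sum>l\<in>J. x l * A $$ (i, l)) = (\<Sum>l\<in>{j, k}. x l * A $$ (i, l))"
        by (rule sum.mono_neutral_right) (use fin jk in \<open>auto simp: x_def\<close>)
      then show "(\<Sum>l\<in>J. x l * A $$ (i, l)) = 0"
        using jk entries[of i] \<open>i < dim_row A\<close> A by (simp add: x_def)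
    qed (rule jk(1))
    then show False by (simp add: x_def)
  qed
  have "lin_indpt (col A ` J)"
  proof (rule finite_lin_indpt2)
    show "finite (col A ` J)" using fin by simp
    show "col A ` J \<subseteq> carrier_vec n" using A by auto
    fix a assume "lincomb a (col A ` J) = 0\<^sub>v n"
    then have "(\<Sum>j\<in>J. a (col A j) * A $$ (i, j)) = 0" if "i < dim_row A" for i
      using lincomb_cols_index[OF A J inj, of i a] that A by auto
    then have "a (col A j) = 0" if "j \<in> J" for j
      using indep_colsD[OF ind, of "\<lambda>j. a (col A j)"] that by blast
    then show "\<forall>v\<in>col A ` J. a v = 0" by auto
  qed
  then have "card (col A ` J) \<le> rank A"
    using J A by (intro rank_ge_card_indpt[OF A]) (auto simp: cols_def)
  then show ?thesis by (simp add: card_image[OF inj])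
qed

text \<open>A maximal independent set of column vectors has as many elements as the rank;
  \<open>J\<close> selects one index for each of these vectors.\<close>

lemma obtain_indep_cols_of_rank:
  assumes A: "A \<in> carrier_mat n nc"
  obtains J where "J \<subseteq> {..<nc}" "card J = rank A" "indep_cols A J"
proof -
  have "lin_indpt {}" by (rule finite_lin_indpt2) auto
  then obtain U where U: "maximal U (\<lambda>T. T \<subseteq> set (cols A) \<and> lin_indpt T)"
    using maximal_exists_superset[of "set (cols A)" "\<lambda>T. T \<subseteq> set (cols A) \<and> lin_indpt T" "{}"]
    by auto
  then have UA: "U \<subseteq> set (cols A)" and ind: "lin_indpt U"
    unfolding maximal_def by blast+
  have "U \<subseteq> col A ` {..<nc}" using UA A by (simp add: cols_def atLeast0LessThan)
  then obtain J where J: "J \<subseteq> {..<nc}" "inj_on (col A) J" "U = col A ` J"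
    using subset_image_inj by metis
  have "card J = rank A" using rank_card_indpt[OF A U] J by (simp add: card_image)
  moreover have "indep_cols A J"
    unfolding indep_cols_def
  proof (intro allI impI ballI)
    fix x j assume x: "\<forall>i<dim_row A. (\<Sum>j\<in>J. x j * A $$ (i, j)) = 0" and j: "j \<in> J"
    \<comment> \<open>Carries coefficients from indices to vectors, using that \<open>col A\<close>
      is injective on \<open>J\<close>.\<close>
    define a where "a = x \<circ> inv_into J (col A)"
    have a: "a (col A j) = x j" if "j \<in> J" for j using that J(2) by (simp add: a_def)
    have UC: "U \<subseteq> carrier_vec n" using J A by auto
    have "lincomb a U = 0\<^sub>v n"
    proof (rule eq_vecI)
      fix i assume i: "i < dim_vec (0\<^sub>v n :: 'a vec)"
      then have "lincomb a U $ i = (\<Sum>j\<in>J. a (col A j) * A $$ (i, j))"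
        using lincomb_cols_index[OF A J(1,2)] J(3) by simp
      also have "\<dots> = (\<Sum>j\<in>J. x j * A $$ (i, j))" by (rule sum.cong) (simp_all add: a)
      finally show "lincomb a U $ i = 0\<^sub>v n $ i" using x i A by simp
    qed (use lincomb_dim[OF _ UC] J finite_subset in auto)
    moreover have "finite U" using J finite_subset by blast
    ultimately have "a \<in> U \<rightarrow> {\<zero>\<^bsub>class_ring\<^esub>}"
      using not_lindepD[OF ind] by auto
    then have "a (col A j) = 0" using j J(3) by auto
    then show "x j = 0" using a[OF j] by simp
  qed
  ultimately show ?thesis using that J(1) by blast
qed

end

text \<open>The Schur complement of the last diagonal entry, scaled by that entry.\<close>

definition corner_eliminated :: "nat \<Rightarrow> nat \<Rightarrow> 'a::comm_ring_1 mat \<Rightarrow> 'a mat" where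
  "corner_eliminated d n L =
    mat d n (\<lambda>(i, j). L $$ (d, n) * L $$ (i, j) - L $$ (i, n) * L $$ (d, j))"

text \<open>Independent columns \<open>J\<close> of the Schur complement, together with column
  \<open>n\<close>, are independent in \<open>L\<close>. In a relation among them, \<open>?c\<close>
  times row \<open>i\<close> minus \<open>L $$ (i, n)\<close> times row \<open>d\<close> eliminates
  \<open>x n\<close> and leaves a relation in the complement; row \<open>d\<close> then forces
  \<open>x n = 0\<close>.\<close>

lemma rank_corner_eliminated:
  fixes L :: "'a::field mat"
  assumes L: "L \<in> carrier_mat (Suc d) (Suc n)" and c: "L $$ (d, n) \<noteq> 0"
  shows "Suc (vec_space.rank d (corner_eliminated d n L)) \<le> vec_space.rank (Suc d) L"
proof -
  let ?S = "corner_eliminated d n L" and ?c = "L $$ (d, n)"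
  have S: "?S \<in> carrier_mat d n" by (simp add: corner_eliminated_def)
  obtain J where J: "J \<subseteq> {..<n}" "card J = vec_space.rank d ?S" "indep_cols ?S J"
    using vec_space.obtain_indep_cols_of_rank[OF S] by blast
  have fin: "finite J" and n: "n \<notin> J" using J(1) finite_subset by auto
  have "indep_cols L (insert n J)"
    unfolding indep_cols_def
  proof (intro allI impI)
    fix x assume "\<forall>i<dim_row L. (\<Sum>j\<in>insert n J. x j * L $$ (i, j)) = 0"
    then have x: "x n * L $$ (i, n) + (\<Sum>j\<in>J. x j * L $$ (i, j)) = 0" if "i < Suc d" for i
      using that L fin n by auto
    have xJ: "x j = 0" if "j \<in> J" for j
    proof (rule indep_colsD[OF J(3) _ that])
      fix i assume "i < dim_row ?S"
      then have i: "i < d" using S by simp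
      have "(\<Sum>j\<in>J. x j * ?S $$ (i, j))
          = (\<Sum>j\<in>J. ?c * (x j * L $$ (i, j)) - L $$ (i, n) * (x j * L $$ (d, j)))"
        by (rule sum.cong) (use i J(1) in \<open>auto simp: corner_eliminated_def algebra_simps\<close>)
      also have "\<dots> = ?c * (\<Sum>j\<in>J. x j * L $$ (i, j)) - L $$ (i, n) * (\<Sum>j\<in>J. x j * L $$ (d, j))"
        by (simp add: sum_subtractf sum_distrib_left)
      also have "(\<Sum>j\<in>J. x j * L $$ (i, j)) = - (x n * L $$ (i, n))"
        using x[of i] i by (simp add: eq_neg_iff_add_eq_0 add.commute)
      also have "(\<Sum>j\<in>J. x j * L $$ (d, j)) = - (x n * ?c)"
        using x[of d] by (simp add: eq_neg_iff_add_eq_0 add.commute)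
      finally show "(\<Sum>j\<in>J. x j * ?S $$ (i, j)) = 0" by simp
    qed
    then have "x n = 0" using x[of d] c by simp
    then show "\<forall>j\<in>insert n J. x j = 0" using xJ by simp
  qed
  moreover have "insert n J \<subseteq> {..<Suc n}" using J(1) by auto
  ultimately have "card (insert n J) \<le> vec_space.rank (Suc d) L"
    using vec_space.card_indep_cols_le_rank[OF L] by blast
  then show ?thesis using J(2) fin n by simp
qed

section \<open>Degrees, lifts and the Kapranov rank of the bordered matrix\<close>

lemma hdeg_mult:
  assumes "hdeg f = ereal a" "hdeg g = ereal b"
  shows "hdeg (f * g) = ereal (a + b)"
proof -
  have f: "hcoeff f a \<noteq> 0" "\<And>e. e < a \<Longrightarrow> hcoeff f e = 0"
    and g: "hcoeff g b \<noteq> 0" "\<And>e. e < b \<Longrightarrow> hcoeff g e = 0"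
    using assms by (auto simp: hdeg_eq_iff)
  \<comment> \<open>The two lowest exponents are the only pair with sum \<open>a + b\<close>, so the
    leading coefficients multiply without cancellation.\<close>
  have "x = a \<and> y = b" if "x \<in> hsupp f" "y \<in> hsupp g" "x + y = a + b" for x y
  proof -
    have "\<not> x < a" "\<not> y < b" using f(2) g(2) that by (auto simp: hsupp_def)
    then show ?thesis using that(3) by linarith
  qed
  then have "sum_pairs (hsupp f) (hsupp g) (a + b) = {(a, b)}"
    using f(1) g(1) by (auto simp: sum_pairs_def hsupp_def)
  then have "hcoeff (f * g) (a + b) \<noteq> 0" using f(1) g(1) by (simp add: hcoeff_mult)
  then show ?thesis using hcoeff_mult_below[of a f b g] f(2) g(2) by (simp add: hdeg_eq_iff)
qed

text \<open>All terms of \<open>g\<close> lie strictly above exponent \<open>a\<close>, so the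
  leading term of \<open>f\<close> survives.\<close>

lemma hdeg_diff:
  assumes "hdeg f = ereal a" "hdeg g = ereal b" "a < b"
  shows "hdeg (f - g) = ereal a"
  using assms by (auto simp: hdeg_eq_iff)

definition is_lift :: "real mat \<Rightarrow> hahn mat \<Rightarrow> bool" where
  "is_lift B L \<longleftrightarrow> L \<in> carrier_mat (dim_row B) (dim_col B) \<and>
     (\<forall>i<dim_row B. \<forall>j<dim_col B. hdeg (L $$ (i, j)) = ereal (B $$ (i, j)))"

lemma kapranov_rank_le:
  "is_lift B L \<Longrightarrow> kapranov_rank B \<le> vec_space.rank (dim_row B) L"
  unfolding kapranov_rank_def is_lift_def by (rule Least_le) blast

text \<open>Some lift always exists, so the \<open>LEAST\<close> in the definition is
  attained.\<close>

lemma obtain_lift_of_kapranov_rank: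
  obtains L where "is_lift B L" "vec_space.rank (dim_row B) L = kapranov_rank B"
proof -
  have "\<exists>r. \<exists>L. is_lift B L \<and> vec_space.rank (dim_row B) L = r"
    using kapranov_lift_exists[of B] by (auto simp: is_lift_def)
  from LeastI_ex[OF this] show ?thesis
    using that unfolding kapranov_rank_def is_lift_def by (auto simp: conj_assoc)
qed

text \<open>The corner of \<open>L\<close> has degree \<open>0\<close>, so the first product keeps
  the degree of the \<open>A\<close>-block entry. The correction has degree \<open>P + P\<close>,
  which is strictly larger and cannot disturb it.\<close>

lemma is_lift_corner_eliminated:
  assumes P: "\<And>i j. i < dim_row A \<Longrightarrow> j < dim_col A \<Longrightarrow> A $$ (i, j) < 2 * P"
    and L: "is_lift (bordered_mat P A) L"
  shows "is_lift A (corner_eliminated (dim_row A) (dim_col A) L)"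
proof -
  let ?d = "dim_row A" and ?n = "dim_col A"
  have deg: "hdeg (L $$ (i, j)) = ereal (bordered_mat P A $$ (i, j))" if "i \<le> ?d" "j \<le> ?n" for i j
    using L that by (simp add: is_lift_def)
  have "hdeg (L $$ (?d, ?n) * L $$ (i, j) - L $$ (i, ?n) * L $$ (?d, j)) = ereal (A $$ (i, j))"
    if "i < ?d" "j < ?n" for i j
  proof (rule hdeg_diff)
    show "hdeg (L $$ (?d, ?n) * L $$ (i, j)) = ereal (A $$ (i, j))"
      using hdeg_mult[OF deg deg, of ?d ?n i j] that by simp
    show "hdeg (L $$ (i, ?n) * L $$ (?d, j)) = ereal (2 * P)"
      using hdeg_mult[OF deg deg, of i ?n ?d j] that by simp
  qed (rule P[OF that])
  then show ?thesis by (simp add: is_lift_def corner_eliminated_def)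
qed

lemma kapranov_rank_bordered:
  assumes P: "\<And>i j. i < dim_row A \<Longrightarrow> j < dim_col A \<Longrightarrow> A $$ (i, j) < 2 * P"
  shows "Suc (kapranov_rank A) \<le> kapranov_rank (bordered_mat P A)"
proof -
  let ?d = "dim_row A" and ?n = "dim_col A"
  obtain L where L: "is_lift (bordered_mat P A) L"
    and rk: "vec_space.rank (Suc ?d) L = kapranov_rank (bordered_mat P A)"
    using obtain_lift_of_kapranov_rank[of "bordered_mat P A"] by auto
  have "hdeg (L $$ (?d, ?n)) = ereal 0"
    \<comment> \<open>The corner entry \<open>0\<close> is a real degree, not \<infinity>, so it
      describes a nonzero series and can serve as pivot.\<close>
    using L by (simp add: is_lift_def)
  then have "L $$ (?d, ?n) \<noteq> 0" by (auto simp: hdeg_eq_iff)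
  then have "Suc (vec_space.rank ?d (corner_eliminated ?d ?n L)) \<le> vec_space.rank (Suc ?d) L"
    using L by (intro rank_corner_eliminated) (auto simp: is_lift_def)
  then show ?thesis
    using kapranov_rank_le[OF is_lift_corner_eliminated[OF P L]] rk by simp
qed

theorem theorem4p3:
  fixes A :: "real mat" and d n r :: nat
  assumes "A \<in> carrier_mat d n"
    and "tropical_rank A = r"
    and "kapranov_rank A > r"
  shows "\<exists>B :: real mat. B \<in> carrier_mat (d + 1) (n + 1) \<and>
    tropical_rank B = r + 1 \<and> kapranov_rank B > r + 1"
proof -
  obtain P where P: "\<And>i j. i < dim_row A \<Longrightarrow> j < dim_col A \<Longrightarrow> A $$ (i, j) < 2 * P"
  proof
    fix i j assume ij: "i < dim_row A" "j < dim_col A"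
    \<comment> \<open>The witness \<open>(Max ?E + 1) / 2\<close> makes \<open>2 * P\<close> one
      more than the largest entry; for a matrix without entries the condition on \<open>P\<close> is
      vacuous.\<close>
    let ?E = "(\<lambda>ij. A $$ ij) ` ({..<dim_row A} \<times> {..<dim_col A})"
    have "A $$ (i, j) \<le> Max ?E" using ij by (intro Max_ge) auto
    then show "A $$ (i, j) < 2 * ((Max ?E + 1) / 2)" by simp
  qed
  show ?thesis
  proof (intro exI[of _ "bordered_mat P A"] conjI)
    show "bordered_mat P A \<in> carrier_mat (d + 1) (n + 1)"
      using assms(1) by (auto simp: bordered_mat_def)
  qed (use tropical_rank_bordered[OF P] kapranov_rank_bordered[OF P] assms in auto)
qed

end
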